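(* Suppose that $\{a_n\}_{n\ge0}$ is an even sequence with $a_0\neq0$, and let $A_n=\frac{1}{(n+1)(n+2)}\sum_{k=0}^na_k$ for $n\ge0$. Then $\{A_n\}_{n\ge0}$ is an even sequence.
   Context: A sequence $\{a_n\}_{n\ge0}$ of real (or complex) numbers is called an even sequence if $\sum_{k=0}^n\binom nk(-1)^ka_k=a_n$ for all $n=0,1,2,\ldots$. *)

theory Defs
  imports Complex_Main
begin

text \<open>By the Gelfand--Mazur theorem, the instances of class \<^class>\<open>real_normed_field\<close> (whose norm
  is multiplicative) are, up to isomorphism, exactly the real and the complex numbers, so the class
  expresses sequences of real or complex numbers.\<close>

definition even_sequence :: "(nat \<Rightarrow> 'a::real_normed_field) \<Rightarrow> bool" where
  "even_sequence a \<longleftrightarrow> (\<forall>n. (\<Sum>k=0..n. of_nat (n choose k) * (-1) ^ k * a k) = a n)"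

end

theory Submission
  imports Defs
begin

text \<open>Since $\binom nk/((k+1)(k+2)) = \binom{n+2}{k+2}/((n+1)(n+2))$, the claim is that
  $\sum_{k\le n}\binom{n+2}{k+2}(-1)^k S_k = S_n$ for the partial sums $S_k$ of $a$. Summation by
  parts turns the left-hand side into $\sum_{k\le n}\binom{n+1}{k+1}(-1)^k a_k$, whose difference in
  $n$ is the binomial transform of $a$, that is, $a$ itself.\<close>

text \<open>With \<open>B k = (-1) ^ k * (N choose Suc k)\<close>, Pascal's rule makes the
  coefficient on the left equal to \<open>B k - B (Suc k)\<close>, so this is Abel summation with
  boundary term \<open>- B (Suc m)\<close> times the last partial sum. Keeping \<open>m\<close>
  independent of \<open>N\<close> lets the induction run on \<open>m\<close> alone.\<close>

lemma alternating_binomial_sum_by_parts: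
  fixes a :: "nat \<Rightarrow> 'a::comm_ring_1"
  shows "(\<Sum>k=0..m. of_nat (Suc N choose (k + 2)) * (-1) ^ k * (\<Sum>j=0..k. a j)) =
    (\<Sum>k=0..m. of_nat (N choose Suc k) * (-1) ^ k * a k) +
    (-1) ^ m * of_nat (N choose (m + 2)) * (\<Sum>j=0..m. a j)"
  by (induction m) (simp_all add: algebra_simps)

lemma even_sequence_partial_sums:
  assumes "even_sequence a"
  shows "(\<Sum>k=0..n. of_nat (Suc n choose Suc k) * (-1) ^ k * a k) = (\<Sum>k=0..n. a k)"
proof (induction n)
  case 0
  then show ?case by simp
next
  case (Suc n)
  have "(\<Sum>k=0..Suc n. of_nat (Suc (Suc n) choose Suc k) * (-1) ^ k * a k) =
      (\<Sum>k=0..Suc n. of_nat (Suc n choose k) * (-1) ^ k * a k) +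
      (\<Sum>k=0..Suc n. of_nat (Suc n choose Suc k) * (-1) ^ k * a k)"
    by (simp only: binomial_Suc_Suc of_nat_add distrib_right sum.distrib)
  also have "(\<Sum>k=0..Suc n. of_nat (Suc n choose k) * (-1) ^ k * a k) = a (Suc n)"
    using assms unfolding even_sequence_def by blast
  \<comment> \<open>The top term \<open>k = Suc n\<close> has coefficient zero, which leaves the sum
    of the induction hypothesis.\<close>
  also have "(\<Sum>k=0..Suc n. of_nat (Suc n choose Suc k) * (-1) ^ k * a k) = (\<Sum>k=0..n. a k)"
    using Suc.IH by (simp del: binomial_Suc_Suc add: binomial_eq_0)
  finally show ?case by simp
qed

text \<open>The absorption rule \<open>Suc_times_binomial\<close>, applied twice, gives a
  division-free identity in the naturals; it is then cast to the field, where characteristic 0 makes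
  the denominators nonzero.\<close>

lemma binomial_absorption_two:
  "of_nat (n choose k) * (1 / (of_nat (k + 1) * of_nat (k + 2))) =
    1 / (of_nat (n + 1) * of_nat (n + 2)) * (of_nat (n + 2 choose (k + 2)) :: 'a::field_char_0)"
proof -
  have "(k + 2) * (k + 1) * (n + 2 choose (k + 2)) =
      Suc k * (Suc (Suc k) * (Suc (Suc n) choose Suc (Suc k)))"
    by (simp only: add_2_eq_Suc' Suc_eq_plus1 [symmetric] mult_ac)
  also have "\<dots> = Suc (Suc n) * (Suc k * (Suc n choose Suc k))"
    by (simp only: Suc_times_binomial [of "Suc k"] mult.left_commute)
  also have "\<dots> = (n + 1) * (n + 2) * (n choose k)"
    by (simp only: Suc_times_binomial add_2_eq_Suc' Suc_eq_plus1 [symmetric]) (simp only: mult_ac)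
  finally have "of_nat ((k + 2) * (k + 1) * (n + 2 choose (k + 2))) =
      (of_nat ((n + 1) * (n + 2) * (n choose k)) :: 'a)"
    by (rule arg_cong)
  moreover have "(of_nat (k + 1) :: 'a) \<noteq> 0" "(of_nat (k + 2) :: 'a) \<noteq> 0"
    "(of_nat (n + 1) :: 'a) \<noteq> 0" "(of_nat (n + 2) :: 'a) \<noteq> 0"
    unfolding of_nat_eq_0_iff by simp_all
  ultimately show ?thesis
    unfolding of_nat_mult by (simp add: divide_simps mult_ac del: of_nat_add of_nat_Suc)
qed

theorem theorem2p9:
  fixes a A :: "nat \<Rightarrow> 'a::real_normed_field"
  assumes "even_sequence a"
    and "a 0 \<noteq> 0"
    and "\<And>n. A n = 1 / (of_nat (n + 1) * of_nat (n + 2)) * (\<Sum>k=0..n. a k)"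
  shows "even_sequence A"
  unfolding even_sequence_def
proof
  fix n
  let ?c = "1 / (of_nat (n + 1) * of_nat (n + 2)) :: 'a"
  let ?S = "\<lambda>k. \<Sum>j=0..k. a j"
  have "of_nat (n choose k) * (-1) ^ k * A k =
      ?c * (of_nat (n + 2 choose (k + 2)) * (-1) ^ k * ?S k)" for k
  proof -
    have "of_nat (n choose k) * (-1) ^ k * A k =
        of_nat (n choose k) * (1 / (of_nat (k + 1) * of_nat (k + 2))) * ((-1) ^ k * ?S k)"
      unfolding assms(3) by (simp only: mult_ac)
    then show ?thesis
      unfolding binomial_absorption_two by (simp only: mult_ac)
  qed
  \<comment> \<open>Writing \<open>n + 2\<close> as \<open>Suc (Suc n)\<close> prepares the
    summation by parts with \<open>N = Suc n\<close>.\<close>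
  then have "(\<Sum>k=0..n. of_nat (n choose k) * (-1) ^ k * A k) =
      ?c * (\<Sum>k=0..n. of_nat (Suc (Suc n) choose (k + 2)) * (-1) ^ k * ?S k)"
    by (simp only: sum_distrib_left add_2_eq_Suc')
  \<comment> \<open>For \<open>m = n\<close> the boundary term carries
    \<open>Suc n choose (n + 2)\<close>, which is zero.\<close>
  also have "\<dots> = ?c * (\<Sum>k=0..n. of_nat (Suc n choose Suc k) * (-1) ^ k * a k)"
    unfolding alternating_binomial_sum_by_parts by (simp add: binomial_eq_0 del: binomial_Suc_Suc)
  also have "\<dots> = A n"
    unfolding even_sequence_partial_sums[OF assms(1)] assms(3) ..
  finally show "(\<Sum>k=0..n. of_nat (n choose k) * (-1) ^ k * A k) = A n" .
qed

end
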